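(* Let $\mathcal{F}\subseteq\mathcal{P}(\mathbb{N})$ be a translation invariant and dilation invariant family with the Ramsey property. Let $\langle x_n\rangle_{n=1}^{\infty}$ be an almost $\mathcal{F}$ minimal sequence in $\mathbb{N}$ and let $A$ be an essential $\mathcal{F}^{\star}$ set in $(\mathbb{N},+)$. Then there exists a sum subsystem $\langle y_n\rangle_{n=1}^{\infty}$ of $\langle x_n\rangle_{n=1}^{\infty}$ such that $$FS(\langle y_n\rangle_{n=1}^{\infty})\cup FP(\langle y_n\rangle_{n=1}^{\infty})\subseteq A.$$
   Context: $\mathbb{N}=\{1,2,3,\dots\}$. A family is a non-empty collection $\mathcal{F}\subseteq\mathcal{P}(\mathbb{N})$ that is upward hereditary (if $A\in\mathcal{F}$ and $A\subseteq B\subseteq\mathbb{N}$ then $B\in\mathcal{F}$); families are taken to be proper, i.e. $\emptyset\notin\mathcal{F}$. $\mathcal{F}$ has the Ramsey property if whenever $A\in\mathcal{F}$ and $A=A_1\cup A_2$, some $A_i\in\mathcal{F}$. For $x\in\mathbb{N}$, $A\subseteq\mathbb{N}$: $-x+A=\{y\in\mathbb{N}:x+y\in A\}$, $x+A=\{x+a:a\in A\}$, $xA=\{xa:a\in A\}$. $\mathcal{F}$ is translation invariant if $A\in\mathcal{F}$ and $n\in\mathbb{N}$ imply $n+A\in\mathcal{F}$ and $-n+A\in\mathcal{F}$; it is dilation invariant if $A\in\mathcal{F}$ and $n\in\mathbb{N}$ imply $nA\in\mathcal{F}$. $\beta\mathbb{N}$ is the set of ultrafilters on $\mathbb{N}$,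 topologized with basis $\{\overline{A}:A\subseteq\mathbb{N}\}$, $\overline{A}=\{p\in\beta\mathbb{N}:A\in p\}$, with the operation: $A\in p+q$ iff $\{x\in\mathbb{N}:-x+A\in q\}\in p$. The closure in $\beta\mathbb{N}$ of $A\subseteq\mathbb{N}$ is $cl(A)=\overline{A}$. Let $\beta(\mathcal{F})=\{p\in\beta\mathbb{N}:p\subseteq\mathcal{F}\}$. A set is an essential $\mathcal{F}$ set if it belongs to some idempotent $p=p+p$ in $\beta(\mathcal{F})$. A set $A\subseteq\mathbb{N}$ is an essential $\mathcal{F}^{\star}$ set if it intersects every essential $\mathcal{F}$ set (equivalently, it belongs to every idempotent in $\beta(\mathcal{F})$). For a sequence, $FS(\langle x_n\rangle_{n=m}^{\infty})=\{\sum_{t\in H}x_t: H\text{ finite non-empty},\ H\subseteq\{m,m+1,\dots\}\}$, and $FP$ is defined likewise with products in place of sums. The sequence $\langle x_n\rangle_{n=1}^{\infty}$ in $\mathbb{N}$ is almost $\mathcal{F}$ minimal if $\bigcap_{m=1}^{\infty}cl(FS(\langle x_n\rangle_{n=m}^{\infty}))\cap\beta(\mathcal{F})\neq\emptyset$. $\langle y_n\rangle_{n=1}^{\infty}$ is a sum subsystem of $\langle x_n\rangle_{n=1}^{\infty}$ if there are non-empty finite sets $H_n\subseteq\mathbb{N}$ with $\max H_n<\min H_{n+1}$ and $y_n=\sum_{t\in H_n}x_t$ for each $n\in\mathbb{N}$. *)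

theory Defs
  imports "HOL-Analysis.Analysis"
begin

text \<open>
  The positive integers are the set \<^term>\<open>{1::nat..}\<close>; families and ultrafilters are sets of
  subsets of it. A sequence indexed by the positive integers is a function on
  \<^typ>\<open>nat\<close> whose value at 0 is never used.
\<close>

abbreviation pnats :: "nat set" where
  "pnats \<equiv> {1..}"

definition is_family :: "nat set set \<Rightarrow> bool" where
  "is_family \<F> \<longleftrightarrow> \<F> \<subseteq> Pow pnats \<and> \<F> \<noteq> {} \<and> {} \<notin> \<F> \<and>
     (\<forall>A B. A \<in> \<F> \<and> A \<subseteq> B \<and> B \<subseteq> pnats \<longrightarrow> B \<in> \<F>)"

definition ramsey_property :: "nat set set \<Rightarrow> bool" where
  "ramsey_property \<F> \<longleftrightarrow>
     (\<forall>A A1 A2. A \<in> \<F> \<and> A = A1 \<union> A2 \<longrightarrow> A1 \<in> \<F> \<or> A2 \<in> \<F>)"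

text \<open>The set written \<open>-x + A\<close>.\<close>

definition left_shift :: "nat \<Rightarrow> nat set \<Rightarrow> nat set" where
  "left_shift x A = {y \<in> pnats. x + y \<in> A}"

definition translation_invariant :: "nat set set \<Rightarrow> bool" where
  "translation_invariant \<F> \<longleftrightarrow>
     (\<forall>A\<in>\<F>. \<forall>n\<in>pnats. (\<lambda>a. n + a) ` A \<in> \<F> \<and> left_shift n A \<in> \<F>)"

definition dilation_invariant :: "nat set set \<Rightarrow> bool" where
  "dilation_invariant \<F> \<longleftrightarrow> (\<forall>A\<in>\<F>. \<forall>n\<in>pnats. (\<lambda>a. n * a) ` A \<in> \<F>)"

definition betaN :: "nat set set set" where
  "betaN = {p. p \<subseteq> Pow pnats \<and> pnats \<in> p \<and> {} \<notin> p \<and>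
     (\<forall>A\<in>p. \<forall>B\<in>p. A \<inter> B \<in> p) \<and>
     (\<forall>A B. A \<in> p \<and> A \<subseteq> B \<and> B \<subseteq> pnats \<longrightarrow> B \<in> p) \<and>
     (\<forall>A. A \<subseteq> pnats \<longrightarrow> A \<in> p \<or> pnats - A \<in> p)}"

definition basic_clopen :: "nat set \<Rightarrow> nat set set set" where
  "basic_clopen A = {p \<in> betaN. A \<in> p}"

definition betaN_topology :: "nat set set topology" where
  "betaN_topology = topology (arbitrary union_of (\<lambda>U. \<exists>A\<subseteq>pnats. U = basic_clopen A))"

definition principal_uf :: "nat \<Rightarrow> nat set set" where
  "principal_uf n = {A. A \<subseteq> pnats \<and> n \<in> A}"

text \<open>The closure of a set of positive integers, embedded by principal ultrafilters.\<close>

definition cl :: "nat set \<Rightarrow> nat set set set" where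
  "cl A = betaN_topology closure_of (principal_uf ` A)"

definition uf_add :: "nat set set \<Rightarrow> nat set set \<Rightarrow> nat set set" where
  "uf_add p q = {A. A \<subseteq> pnats \<and> {x \<in> pnats. left_shift x A \<in> q} \<in> p}"

definition beta_family :: "nat set set \<Rightarrow> nat set set set" where
  "beta_family \<F> = {p \<in> betaN. p \<subseteq> \<F>}"

definition essential :: "nat set set \<Rightarrow> nat set \<Rightarrow> bool" where
  "essential \<F> A \<longleftrightarrow> (\<exists>p \<in> beta_family \<F>. p = uf_add p p \<and> A \<in> p)"

definition essential_star :: "nat set set \<Rightarrow> nat set \<Rightarrow> bool" where
  "essential_star \<F> A \<longleftrightarrow> A \<subseteq> pnats \<and> (\<forall>B. essential \<F> B \<longrightarrow> A \<inter> B \<noteq> {})"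

definition FS :: "(nat \<Rightarrow> nat) \<Rightarrow> nat \<Rightarrow> nat set" where
  "FS x m = {\<Sum>t\<in>H. x t | H. finite H \<and> H \<noteq> {} \<and> H \<subseteq> {m..}}"

definition FP :: "(nat \<Rightarrow> nat) \<Rightarrow> nat \<Rightarrow> nat set" where
  "FP x m = {\<Prod>t\<in>H. x t | H. finite H \<and> H \<noteq> {} \<and> H \<subseteq> {m..}}"

definition almost_minimal :: "nat set set \<Rightarrow> (nat \<Rightarrow> nat) \<Rightarrow> bool" where
  "almost_minimal \<F> x \<longleftrightarrow> (\<Inter>m\<in>pnats. cl (FS x m)) \<inter> beta_family \<F> \<noteq> {}"

definition sum_subsystem :: "(nat \<Rightarrow> nat) \<Rightarrow> (nat \<Rightarrow> nat) \<Rightarrow> bool" where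
  "sum_subsystem y x \<longleftrightarrow> (\<exists>H :: nat \<Rightarrow> nat set. \<forall>n\<in>pnats.
     finite (H n) \<and> H n \<noteq> {} \<and> H n \<subseteq> pnats \<and>
     Max (H n) < Min (H (n + 1)) \<and> y n = (\<Sum>t\<in>H n. x t))"

lemma basic_clopen_Int:
  assumes "A \<subseteq> pnats" "B \<subseteq> pnats"
  shows "basic_clopen A \<inter> basic_clopen B = basic_clopen (A \<inter> B)"
proof -
  have "A \<inter> B \<in> p \<longleftrightarrow> A \<in> p \<and> B \<in> p" if p: "p \<in> betaN" for p
  proof
    have up: "D \<in> p" if "C \<in> p" "C \<subseteq> D" "D \<subseteq> pnats" for C D
      using p that unfolding betaN_def by blast
    show "A \<in> p \<and> B \<in> p" if "A \<inter> B \<in> p"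
      using up[OF that, of A] up[OF that, of B] assms by blast
  next
    show "A \<inter> B \<in> p" if "A \<in> p \<and> B \<in> p"
      using p that unfolding betaN_def by blast
  qed
  then show ?thesis
    by (auto simp: basic_clopen_def)
qed

lemma openin_betaN_topology:
  "openin betaN_topology = arbitrary union_of (\<lambda>U. \<exists>A\<subseteq>pnats. U = basic_clopen A)"
proof -
  have "istopology (arbitrary union_of (\<lambda>U. \<exists>A\<subseteq>pnats. U = basic_clopen A))"
  proof (rule istopology_base)
    fix S T
    assume "\<exists>A\<subseteq>pnats. S = basic_clopen A" "\<exists>A\<subseteq>pnats. T = basic_clopen A"
    then obtain A B where "A \<subseteq> pnats" "S = basic_clopen A" "B \<subseteq> pnats" "T = basic_clopen B"
      by blast
    then show "\<exists>A\<subseteq>pnats. S \<inter> T = basic_clopen A"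
      using basic_clopen_Int[of A B] by (intro exI[of _ "A \<inter> B"]) auto
  qed
  then show ?thesis
    unfolding betaN_topology_def by (rule topology_inverse')
qed

lemma betaN_nhd_basic:
  assumes "openin betaN_topology T" "p \<in> T"
  obtains B where "B \<subseteq> pnats" "p \<in> basic_clopen B" "basic_clopen B \<subseteq> T"
proof -
  have "\<forall>q\<in>T. \<exists>U. (\<exists>A\<subseteq>pnats. U = basic_clopen A) \<and> q \<in> U \<and> U \<subseteq> T"
    using assms(1) by (simp only: openin_betaN_topology arbitrary_union_of_alt)
  then show ?thesis
    using assms(2) that by metis
qed

lemma openin_basic_clopen:
  assumes "A \<subseteq> pnats"
  shows "openin betaN_topology (basic_clopen A)"
  unfolding openin_betaN_topology by (rule arbitrary_union_of_inc) (use assms in auto)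

lemma topspace_betaN_topology: "topspace betaN_topology = betaN"
proof
  show "topspace betaN_topology \<subseteq> betaN"
  proof
    fix p assume "p \<in> topspace betaN_topology"
    then obtain B where "p \<in> basic_clopen B"
      using betaN_nhd_basic[OF openin_topspace] by metis
    then show "p \<in> betaN"
      by (auto simp: basic_clopen_def)
  qed
  have "basic_clopen pnats = betaN"
    by (auto simp: basic_clopen_def betaN_def)
  then show "betaN \<subseteq> topspace betaN_topology"
    using openin_subset[OF openin_basic_clopen[of pnats]] by simp
qed

lemma in_principal_uf: "A \<in> principal_uf n \<longleftrightarrow> A \<subseteq> pnats \<and> n \<in> A"
  by (simp only: principal_uf_def mem_Collect_eq)

lemma principal_uf_in_betaN:
  assumes n: "n \<in> pnats"
  shows "principal_uf n \<in> betaN"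
  unfolding betaN_def mem_Collect_eq
proof (intro conjI ballI allI impI)
  show "principal_uf n \<subseteq> Pow pnats"
    by (rule subsetI) (simp only: in_principal_uf Pow_iff)
  show "pnats \<in> principal_uf n"
    using n by (simp only: in_principal_uf subset_refl simp_thms)
  show "{} \<notin> principal_uf n"
    by (simp only: in_principal_uf empty_iff simp_thms not_False_eq_True)
next
  fix A B assume "A \<in> principal_uf n" "B \<in> principal_uf n"
  then show "A \<inter> B \<in> principal_uf n"
    unfolding in_principal_uf by blast
next
  fix A B assume "A \<in> principal_uf n \<and> A \<subseteq> B \<and> B \<subseteq> pnats"
  then show "B \<in> principal_uf n"
    unfolding in_principal_uf by blast
next
  fix A assume "A \<subseteq> pnats"
  then show "A \<in> principal_uf n \<or> pnats - A \<in> principal_uf n"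
    using n unfolding in_principal_uf by blast
qed

lemma cl_eq_basic_clopen:
  assumes "A \<subseteq> pnats"
  shows "cl A = basic_clopen A"
proof (intro equalityI subsetI)
  fix p assume p: "p \<in> cl A"
  then have pb: "p \<in> betaN"
    unfolding cl_def in_closure_of topspace_betaN_topology by (rule conjunct1)
  show "p \<in> basic_clopen A"
  proof (rule ccontr)
    assume "p \<notin> basic_clopen A"
    then have "p \<in> basic_clopen (pnats - A)"
      using pb assms unfolding basic_clopen_def betaN_def mem_Collect_eq by metis
    then obtain q where "q \<in> principal_uf ` A" "q \<in> basic_clopen (pnats - A)"
      using p openin_basic_clopen[of "pnats - A"] unfolding cl_def in_closure_of
      by (metis Diff_subset)
    then show False
      by (auto simp: basic_clopen_def in_principal_uf)
  qed
next
  fix p assume p: "p \<in> basic_clopen A"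
  then have pb: "p \<in> betaN" "A \<in> p"
    by (auto simp: basic_clopen_def)
  have "\<exists>q. q \<in> principal_uf ` A \<and> q \<in> T" if T: "p \<in> T" "openin betaN_topology T" for T
  proof -
    obtain B where B: "B \<subseteq> pnats" "p \<in> basic_clopen B" "basic_clopen B \<subseteq> T"
      using betaN_nhd_basic[OF T(2,1)] by metis
    then have "p \<in> basic_clopen (A \<inter> B)"
      using p basic_clopen_Int[OF assms B(1)] by blast
    then have "A \<inter> B \<noteq> {}"
      unfolding basic_clopen_def betaN_def mem_Collect_eq by metis
    then obtain a where a: "a \<in> A" "a \<in> B" by blast
    then have "principal_uf a \<in> basic_clopen B"
      using B(1) principal_uf_in_betaN[of a] unfolding basic_clopen_def mem_Collect_eq in_principal_uf by blast
    then show ?thesis using a B(3) by blast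
  qed
  then show "p \<in> cl A"
    unfolding cl_def in_closure_of topspace_betaN_topology using pb by blast
qed

end

theory Submission
  imports Defs
begin

text \<open>
  The proof has a topological half and a combinatorial half. The topological half produces one
  idempotent ultrafilter \<open>p\<close> with three properties: \<open>p \<subseteq> \<F>\<close>, every tail \<open>FS x m\<close> belongs to
  \<open>p\<close>, and every quotient \<open>{m. n * m \<in> A}\<close> belongs to \<open>p\<close>. The ultrafilters with the first two
  properties form a closed set, non-empty because \<open>x\<close> is almost \<open>\<F>\<close> minimal. It is closed under
  addition: a sum of late terms can be added to a given finite sum without repeating an index, and
  translation invariance makes \<^term>\<open>beta_family \<F>\<close> a left ideal
  (\<open>uf_add_beta_family\<close>). The Ellis--Numakura lemma (\<open>ellis_numakura\<close>) therefore gives an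
  idempotent in it. The third property then holds for every idempotent \<open>p \<subseteq> \<F>\<close>: the map
  \<open>m \<mapsto> n * m\<close> is an additive homomorphism, so it carries \<open>p\<close> to another idempotent, which by
  dilation invariance is again contained in \<open>\<F>\<close> and so contains the essential star set \<open>A\<close>
  (\<open>dilation_preimage_mem\<close>).

  In the combinatorial half (\<open>sum_subsystem_from_idempotent\<close>) the terms of \<open>y\<close> are chosen one
  after the other. Let \<open>A\<^sup>*\<close> be the set of those \<open>a \<in> A\<close> for which \<open>-a + A\<close> is in \<open>p\<close>; then
  \<open>-s + A\<^sup>*\<close> is in \<open>p\<close> for every \<open>s \<in> A\<^sup>*\<close> (\<open>idempotent_star\<close>). If the sums so far lie in
  \<open>A\<^sup>*\<close>, then only finitely many members of \<open>p\<close> have to be met in order that all new sums lie in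
  \<open>A\<^sup>*\<close>, all new products lie in \<open>A\<close> and the new term is a sum of unused terms of \<open>x\<close>.
\<close>

section \<open>Idempotents in compact right topological semigroups\<close>

text \<open>
  A minimal closed subsemigroup \<open>M\<close> exists by compactness and Zorn's lemma. For \<open>p \<in> M\<close>, both
  \<open>M * p\<close> and then \<open>{q \<in> M. q * p = p}\<close> are closed subsemigroups of \<open>M\<close>, so each is all of \<open>M\<close>,
  and the latter contains \<open>p\<close>. Only the right multiplications
  \<open>q \<mapsto> q * p\<close> are assumed continuous, since this is what addition of ultrafilters provides.
\<close>

lemma ellis_numakura:
  fixes f :: "'a \<Rightarrow> 'a \<Rightarrow> 'a"
  assumes comp: "compact_space X" and haus: "Hausdorff_space X" and ne: "topspace X \<noteq> {}"
    and closed: "\<And>p q. p \<in> topspace X \<Longrightarrow> q \<in> topspace X \<Longrightarrow> f p q \<in> topspace X"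
    and assoc: "\<And>p q r. p \<in> topspace X \<Longrightarrow> q \<in> topspace X \<Longrightarrow> r \<in> topspace X
                  \<Longrightarrow> f (f p q) r = f p (f q r)"
    and cont: "\<And>q. q \<in> topspace X \<Longrightarrow> continuous_map X X (\<lambda>p. f p q)"
  obtains p where "p \<in> topspace X" "f p p = p"
proof -
  define \<A> where "\<A> = {M. closedin X M \<and> M \<noteq> {} \<and> (\<forall>p\<in>M. \<forall>q\<in>M. f p q \<in> M)}"
  have chain_Inter: "\<Inter>C \<in> \<A>" if C: "C \<noteq> {}" "subset.chain \<A> C" for C
  proof -
    have CA: "C \<subseteq> \<A>" and lin: "\<And>M N. M \<in> C \<Longrightarrow> N \<in> C \<Longrightarrow> M \<subseteq> N \<or> N \<subseteq> M"
      using C(2) by (auto simp: subset_chain_def)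
    have fin: "\<exists>M\<in>C. M \<subseteq> \<Inter>D" if "finite D" "D \<subseteq> C" for D
      using that
    proof (induction D rule: finite_induct)
      case empty
      then show ?case using C(1) by auto
    next
      case (insert N D)
      then obtain M where M: "M \<in> C" "M \<subseteq> \<Inter>D" by auto
      show ?case
      proof (cases "M \<subseteq> N")
        case True then show ?thesis using M by auto
      next
        case False
        then have "N \<subseteq> M" using lin[of M N] insert M by auto
        then show ?thesis using M insert by auto
      qed
    qed
    have "\<forall>D. finite D \<and> D \<subseteq> C \<longrightarrow> \<Inter>D \<noteq> {}"
    proof (intro allI impI)
      fix D assume "finite D \<and> D \<subseteq> C"
      then obtain M where "M \<in> C" "M \<subseteq> \<Inter>D" using fin by blast
      then show "\<Inter>D \<noteq> {}" using CA unfolding \<A>_def by blast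
    qed
    moreover have "\<forall>M\<in>C. closedin X M"
      using CA unfolding \<A>_def by blast
    ultimately have "\<Inter>C \<noteq> {}"
      using comp unfolding compact_space_fip by blast
    moreover have "closedin X (\<Inter>C)"
      using C(1) CA unfolding \<A>_def by (intro closedin_Inter) auto
    moreover have "\<forall>p\<in>\<Inter>C. \<forall>q\<in>\<Inter>C. f p q \<in> \<Inter>C"
      using CA unfolding \<A>_def by blast
    ultimately show ?thesis unfolding \<A>_def by blast
  qed
  have top: "topspace X \<in> \<A>"
    using ne closed by (auto simp: \<A>_def)
  \<comment> \<open>Zorn's lemma is about maximal elements, so it is applied to the complements.\<close>
  have "\<exists>N\<in>(\<lambda>M. topspace X - M) ` \<A>. \<forall>K\<in>(\<lambda>M. topspace X - M) ` \<A>. N \<subseteq> K \<longrightarrow> K = N"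
  proof (rule subset_Zorn_nonempty)
    show "(\<lambda>M. topspace X - M) ` \<A> \<noteq> {}" using top by blast
    fix C assume C: "C \<noteq> {}" "subset.chain ((\<lambda>M. topspace X - M) ` \<A>) C"
    define D where "D = (\<lambda>N. topspace X - N) ` C"
    have sub: "M \<subseteq> topspace X" if "M \<in> \<A>" for M
      using that closedin_subset unfolding \<A>_def by blast
    have Csub: "C \<subseteq> (\<lambda>M. topspace X - M) ` \<A>"
      and Clin: "\<And>M N. M \<in> C \<Longrightarrow> N \<in> C \<Longrightarrow> M \<subseteq> N \<or> N \<subseteq> M"
      using C(2) by (auto simp: subset_chain_def)
    have DA: "D \<subseteq> \<A>"
    proof
      fix M assume "M \<in> D"
      then obtain M' where "M' \<in> \<A>" "M = topspace X - (topspace X - M')"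
        using Csub unfolding D_def by blast
      then show "M \<in> \<A>" using sub[of M'] by (simp add: double_diff)
    qed
    have "subset.chain \<A> D"
      unfolding subset_chain_def
    proof (intro conjI ballI)
      show "D \<subseteq> \<A>" by (fact DA)
      fix M N assume "M \<in> D" "N \<in> D"
      then show "M \<subseteq> N \<or> N \<subseteq> M"
        using Clin unfolding D_def by blast
    qed
    moreover have "D \<noteq> {}" using C(1) unfolding D_def by blast
    ultimately have "\<Inter>D \<in> \<A>" using chain_Inter by blast
    moreover have "\<Union>C = topspace X - \<Inter>D"
      using Csub unfolding D_def by blast
    ultimately show "\<Union>C \<in> (\<lambda>M. topspace X - M) ` \<A>" by blast
  qed
  then obtain M where M: "M \<in> \<A>"
    and max: "\<And>K. K \<in> \<A> \<Longrightarrow> topspace X - M \<subseteq> topspace X - K \<Longrightarrow> topspace X - K = topspace X - M"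
    by blast
  have Mcl: "closedin X M" and Mne: "M \<noteq> {}" and Msg: "\<And>p q. p \<in> M \<Longrightarrow> q \<in> M \<Longrightarrow> f p q \<in> M"
    using M unfolding \<A>_def by auto
  have Msub: "M \<subseteq> topspace X" using Mcl closedin_subset by blast
  have minimal: "K = M" if "K \<in> \<A>" "K \<subseteq> M" for K
    using max[OF that(1)] that(2) Msub by blast
  obtain p where p: "p \<in> M" using Mne by blast
  have pX: "p \<in> topspace X" using p Msub by blast
  have "(\<lambda>q. f q p) ` M \<in> \<A>"
    unfolding \<A>_def mem_Collect_eq
  proof (intro conjI)
    have "compactin X M" using closedin_compact_space[OF comp Mcl] .
    then have "compactin X ((\<lambda>q. f q p) ` M)"
      using image_compactin cont[OF pX] by blast
    then show "closedin X ((\<lambda>q. f q p) ` M)"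
      using compactin_imp_closedin haus by blast
    show "(\<lambda>q. f q p) ` M \<noteq> {}" using p by blast
    show "\<forall>a\<in>(\<lambda>q. f q p) ` M. \<forall>b\<in>(\<lambda>q. f q p) ` M. f a b \<in> (\<lambda>q. f q p) ` M"
    proof (clarify)
      fix q r assume qr: "q \<in> M" "r \<in> M"
      have "f (f q p) (f r p) = f (f (f q p) r) p"
        using qr p Msub closed assoc[of "f q p" r p] by (simp add: subset_iff)
      then show "f (f q p) (f r p) \<in> (\<lambda>q. f q p) ` M"
        using qr p Msg by blast
    qed
  qed
  then have "(\<lambda>q. f q p) ` M = M"
    using minimal Msg p by blast
  then obtain e where e: "e \<in> M" "f e p = p" using p by (metis imageE)
  have "{q \<in> M. f q p = p} \<in> \<A>"
    unfolding \<A>_def mem_Collect_eq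
  proof (intro conjI)
    have "closedin X {p}"
      using haus pX by (simp add: Hausdorff_imp_t1_space closedin_t1_singleton)
    then have "closedin X {q \<in> topspace X. f q p \<in> {p}}"
      using closedin_continuous_map_preimage[OF cont[OF pX]] by blast
    then have "closedin X (M \<inter> {q \<in> topspace X. f q p \<in> {p}})"
      using Mcl by blast
    moreover have "M \<inter> {q \<in> topspace X. f q p \<in> {p}} = {q \<in> M. f q p = p}"
      using Msub by auto
    ultimately show "closedin X {q \<in> M. f q p = p}" by simp
    show "{q \<in> M. f q p = p} \<noteq> {}" using e by blast
    show "\<forall>a\<in>{q \<in> M. f q p = p}. \<forall>b\<in>{q \<in> M. f q p = p}. f a b \<in> M \<and> f (f a b) p = p"
      using Msg assoc Msub p by (auto simp: subset_iff)
  qed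
  then have "{q \<in> M. f q p = p} = M" using minimal by blast
  then have "f p p = p" using p by blast
  then show thesis using that pX by blast
qed

section \<open>The compact space of ultrafilters\<close>

lemma
  assumes p: "p \<in> betaN"
  shows betaN_sub: "B \<in> p \<Longrightarrow> B \<subseteq> pnats"
    and betaN_ne: "{} \<notin> p"
    and betaN_top: "pnats \<in> p"
    and betaN_Int: "B \<in> p \<Longrightarrow> C \<in> p \<Longrightarrow> B \<inter> C \<in> p"
    and betaN_up: "B \<in> p \<Longrightarrow> B \<subseteq> C \<Longrightarrow> C \<subseteq> pnats \<Longrightarrow> C \<in> p"
    and betaN_ultra: "B \<subseteq> pnats \<Longrightarrow> B \<in> p \<or> pnats - B \<in> p"
proof -
  have *: "p \<subseteq> Pow pnats" "pnats \<in> p" "{} \<notin> p" "\<forall>B\<in>p. \<forall>C\<in>p. B \<inter> C \<in> p"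
    "\<forall>B C. B \<in> p \<and> B \<subseteq> C \<and> C \<subseteq> pnats \<longrightarrow> C \<in> p"
    "\<forall>B. B \<subseteq> pnats \<longrightarrow> B \<in> p \<or> pnats - B \<in> p"
    using p unfolding betaN_def mem_Collect_eq by - (elim conjE, assumption)+
  show "{} \<notin> p" "pnats \<in> p" by (fact *)+
  show "B \<subseteq> pnats" if "B \<in> p" using *(1) that by (rule subsetD[THEN PowD])
  show "B \<inter> C \<in> p" if "B \<in> p" "C \<in> p"
    by (rule *(4)[THEN bspec, THEN bspec, OF that])
  show "C \<in> p" if "B \<in> p" "B \<subseteq> C" "C \<subseteq> pnats" using *(5) that by iprover
  show "B \<in> p \<or> pnats - B \<in> p" if "B \<subseteq> pnats" using *(6) that by iprover
qed

lemma betaN_compl_iff: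
  assumes p: "p \<in> betaN" and B: "B \<subseteq> pnats"
  shows "pnats - B \<in> p \<longleftrightarrow> B \<notin> p"
proof
  show "pnats - B \<in> p" if "B \<notin> p" using betaN_ultra[OF p B] that by iprover
  show "B \<notin> p" if "pnats - B \<in> p"
  proof
    assume "B \<in> p"
    then have "B \<inter> (pnats - B) \<in> p" using that by (rule betaN_Int[OF p])
    then show False using betaN_ne[OF p] by (simp only: Diff_disjoint)
  qed
qed

lemma betaN_INT:
  assumes "p \<in> betaN" "finite I" "\<And>i. i \<in> I \<Longrightarrow> B i \<in> p"
  shows "pnats \<inter> (\<Inter>i\<in>I. B i) \<in> p"
  using assms(2,3)
proof (induction I rule: finite_induct)
  case empty
  then show ?case using betaN_top[OF assms(1)] by simp
next
  case (insert i I)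
  then have "B i \<inter> (pnats \<inter> (\<Inter>i\<in>I. B i)) \<in> p"
    using betaN_Int[OF assms(1)] by blast
  moreover have "B i \<inter> (pnats \<inter> (\<Inter>i\<in>I. B i)) = pnats \<inter> (\<Inter>i\<in>insert i I. B i)" by blast
  ultimately show ?case by simp
qed

text \<open>A maximal family with the finite intersection property is an ultrafilter.\<close>

lemma fip_extends_to_ultrafilter:
  assumes "G \<subseteq> Pow pnats" "\<And>D. finite D \<Longrightarrow> D \<subseteq> G \<Longrightarrow> pnats \<inter> \<Inter>D \<noteq> {}"
  obtains p where "p \<in> betaN" "G \<subseteq> p"
proof -
  define \<A> where
    "\<A> = {E. G \<subseteq> E \<and> E \<subseteq> Pow pnats \<and> (\<forall>D. finite D \<and> D \<subseteq> E \<longrightarrow> pnats \<inter> \<Inter>D \<noteq> {})}"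
  have "\<exists>M\<in>\<A>. \<forall>E\<in>\<A>. M \<subseteq> E \<longrightarrow> E = M"
  proof (rule subset_Zorn_nonempty)
    show "\<A> \<noteq> {}" using assms unfolding \<A>_def by blast
    fix C assume C: "C \<noteq> {}" "subset.chain \<A> C"
    have CA: "C \<subseteq> \<A>" using C(2) by (auto simp: subset_chain_def)
    have CE: "G \<subseteq> E" "E \<subseteq> Pow pnats" "\<And>D. finite D \<Longrightarrow> D \<subseteq> E \<Longrightarrow> pnats \<inter> \<Inter>D \<noteq> {}"
      if "E \<in> C" for E
      using subsetD[OF CA that] unfolding \<A>_def by simp_all
    show "\<Union>C \<in> \<A>"
      unfolding \<A>_def mem_Collect_eq
    proof (intro conjI allI impI)
      obtain E where "E \<in> C" using C(1) by blast
      then show "G \<subseteq> \<Union>C" using CE(1) by blast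
      show "\<Union>C \<subseteq> Pow pnats" by (rule Union_least) (rule CE(2))
      fix D assume D: "finite D \<and> D \<subseteq> \<Union>C"
      then obtain E where "E \<in> C" "D \<subseteq> E"
        using finite_subset_Union_chain[of D C \<A>] C by metis
      then show "pnats \<inter> \<Inter>D \<noteq> {}" using CE(3) D by iprover
    qed
  qed
  then obtain M where M: "M \<in> \<A>" and max: "\<And>E. E \<in> \<A> \<Longrightarrow> M \<subseteq> E \<Longrightarrow> E = M" by blast
  have GM: "G \<subseteq> M" and MP: "M \<subseteq> Pow pnats"
    and fip: "\<And>D. finite D \<Longrightarrow> D \<subseteq> M \<Longrightarrow> pnats \<inter> \<Inter>D \<noteq> {}"
    using M unfolding \<A>_def by simp_all
  have meets: "B \<in> M" if B: "B \<subseteq> pnats" "\<And>D. finite D \<Longrightarrow> D \<subseteq> M \<Longrightarrow> pnats \<inter> (B \<inter> \<Inter>D) \<noteq> {}" for B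
  proof -
    have "insert B M \<in> \<A>"
      unfolding \<A>_def mem_Collect_eq
    proof (intro conjI allI impI)
      fix D assume D: "finite D \<and> D \<subseteq> insert B M"
      then have "pnats \<inter> (B \<inter> \<Inter>(D - {B})) \<noteq> {}" by (intro B(2)) auto
      then show "pnats \<inter> \<Inter>D \<noteq> {}" by blast
    qed (use GM MP B(1) in auto)
    then show ?thesis using max[of "insert B M"] by blast
  qed
  have above: "B \<in> M" if "B \<subseteq> pnats" "finite D" "D \<subseteq> M" "pnats \<inter> \<Inter>D \<subseteq> B" for B D
  proof (rule meets)
    fix D' assume "finite D'" "D' \<subseteq> M"
    then have "pnats \<inter> \<Inter>(D \<union> D') \<noteq> {}" using that by (intro fip) auto
    then show "pnats \<inter> (B \<inter> \<Inter>D') \<noteq> {}" using that(4) by blast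
  qed (fact that(1))
  have "M \<in> betaN"
    unfolding betaN_def mem_Collect_eq
  proof (intro conjI ballI allI impI)
    show "M \<subseteq> Pow pnats" by (fact MP)
    show "pnats \<in> M" by (rule above[of _ "{}"]) auto
    show "{} \<notin> M" using fip[of "{{}}"] by auto
  next
    fix B C assume BC: "B \<in> M" "C \<in> M"
    then show "B \<inter> C \<in> M" using MP by (intro above[of _ "{B, C}"]) auto
  next
    fix B C assume "B \<in> M \<and> B \<subseteq> C \<and> C \<subseteq> pnats"
    then show "C \<in> M" by (intro above[of _ "{B}"]) auto
  next
    fix B assume B: "B \<subseteq> pnats"
    show "B \<in> M \<or> pnats - B \<in> M"
    proof (rule disjCI)
      assume "pnats - B \<notin> M"
      then obtain D where D: "finite D" "D \<subseteq> M" "pnats \<inter> ((pnats - B) \<inter> \<Inter>D) = {}"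
        using meets[of "pnats - B"] by blast
      then show "B \<in> M" using B by (intro above[of B D]) auto
    qed
  qed
  then show thesis using that GM by blast
qed

lemma compact_space_betaN: "compact_space betaN_topology"
  unfolding compact_space topspace_betaN_topology
proof (intro allI impI)
  fix \<U> assume "Ball \<U> (openin betaN_topology) \<and> \<Union>\<U> = betaN"
  then have op: "\<And>U. U \<in> \<U> \<Longrightarrow> openin betaN_topology U" and cov: "\<Union>\<U> = betaN" by auto
  define G where "G = {pnats - B | B. B \<subseteq> pnats \<and> (\<exists>U\<in>\<U>. basic_clopen B \<subseteq> U)}"
  \<comment> \<open>An ultrafilter containing \<open>G\<close> would lie in no member of the cover.\<close>
  have "\<not> (\<exists>p\<in>betaN. G \<subseteq> p)"
  proof
    assume "\<exists>p\<in>betaN. G \<subseteq> p"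
    then obtain p where p: "p \<in> betaN" "G \<subseteq> p" by blast
    then obtain U where U: "U \<in> \<U>" "p \<in> U" using cov by blast
    then obtain B where B: "B \<subseteq> pnats" "p \<in> basic_clopen B" "basic_clopen B \<subseteq> U"
      using betaN_nhd_basic[OF op] by metis
    then have "pnats - B \<in> p" using U p(2) unfolding G_def by blast
    then show False using betaN_compl_iff[OF p(1) B(1)] B(2) by (simp add: basic_clopen_def)
  qed
  moreover have GP: "G \<subseteq> Pow pnats" unfolding G_def by blast
  ultimately obtain D where D: "finite D" "D \<subseteq> G" "pnats \<inter> \<Inter>D = {}"
    using fip_extends_to_ultrafilter by metis
  have "\<forall>E\<in>D. \<exists>U\<in>\<U>. basic_clopen (pnats - E) \<subseteq> U"
  proof
    fix E assume "E \<in> D"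
    then obtain B where B: "E = pnats - B" "B \<subseteq> pnats" "\<exists>U\<in>\<U>. basic_clopen B \<subseteq> U"
      using subsetD[OF D(2)] unfolding G_def mem_Collect_eq by iprover
    moreover have "pnats - E = B" unfolding B(1) using B(2) by (rule double_diff) simp
    ultimately show "\<exists>U\<in>\<U>. basic_clopen (pnats - E) \<subseteq> U" by simp
  qed
  then obtain u where u: "\<And>E. E \<in> D \<Longrightarrow> u E \<in> \<U>" "\<And>E. E \<in> D \<Longrightarrow> basic_clopen (pnats - E) \<subseteq> u E"
    by metis
  have "p \<in> \<Union>(u ` D)" if p: "p \<in> betaN" for p
  proof (rule ccontr)
    assume no: "p \<notin> \<Union>(u ` D)"
    have "E \<in> p" if E: "E \<in> D" for E
    proof -
      have "p \<notin> basic_clopen (pnats - E)" using u(2)[OF E] E no by blast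
      moreover have "E \<subseteq> pnats" using E D(2) GP by blast
      ultimately show ?thesis using betaN_compl_iff[OF p] p by (simp add: basic_clopen_def)
    qed
    then have "pnats \<inter> (\<Inter>E\<in>D. E) \<in> p" using betaN_INT[OF p D(1), of "\<lambda>E. E"] by blast
    then show False using D(3) betaN_ne[OF p] by simp
  qed
  moreover have "\<Union>(u ` D) \<subseteq> betaN" using u(1) cov by blast
  ultimately have "\<Union>(u ` D) = betaN" by blast
  then show "\<exists>\<V>. finite \<V> \<and> \<V> \<subseteq> \<U> \<and> \<Union>\<V> = betaN"
    using D(1) u(1) by (intro exI[of _ "u ` D"]) auto
qed

lemma Hausdorff_space_betaN: "Hausdorff_space betaN_topology"
  unfolding Hausdorff_space_def topspace_betaN_topology
proof (intro allI impI)
  fix p q assume "p \<in> betaN \<and> q \<in> betaN \<and> p \<noteq> q"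
  then have pq: "p \<in> betaN" "q \<in> betaN" "p \<noteq> q" by auto
  have "\<exists>B\<subseteq>pnats. B \<in> p \<and> B \<notin> q"
  proof (rule ccontr)
    assume no: "\<not> ?thesis"
    then have "p \<subseteq> q" using betaN_sub[OF pq(1)] by blast
    moreover have "B \<in> p" if B: "B \<in> q" for B
    proof (rule ccontr)
      assume "B \<notin> p"
      moreover have "B \<subseteq> pnats" using betaN_sub[OF pq(2) B] .
      ultimately show False
        using B \<open>p \<subseteq> q\<close> betaN_compl_iff[OF pq(1)] betaN_compl_iff[OF pq(2)] by blast
    qed
    ultimately show False using pq(3) by blast
  qed
  then obtain B where B: "B \<subseteq> pnats" "B \<in> p" "B \<notin> q" by blast
  show "\<exists>U V. openin betaN_topology U \<and> openin betaN_topology V \<and> p \<in> U \<and> q \<in> V \<and> disjnt U V"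
  proof (intro exI conjI)
    show "openin betaN_topology (basic_clopen B)" "openin betaN_topology (basic_clopen (pnats - B))"
      using openin_basic_clopen[OF B(1)] openin_basic_clopen[OF Diff_subset] by blast+
    show "p \<in> basic_clopen B" "q \<in> basic_clopen (pnats - B)"
      using B pq betaN_compl_iff[OF pq(2) B(1)] by (auto simp: basic_clopen_def)
    show "disjnt (basic_clopen B) (basic_clopen (pnats - B))"
      using betaN_compl_iff[OF _ B(1)] unfolding disjnt_def basic_clopen_def by blast
  qed
qed

lemma closedin_basic_clopen:
  assumes "B \<subseteq> pnats"
  shows "closedin betaN_topology (basic_clopen B)"
proof -
  have "betaN - basic_clopen B = basic_clopen (pnats - B)"
    using betaN_compl_iff[OF _ assms] unfolding basic_clopen_def by blast
  then show ?thesis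
    using openin_basic_clopen[of "pnats - B"]
    by (auto simp: closedin_def topspace_betaN_topology basic_clopen_def)
qed

lemma closedin_beta_family: "closedin betaN_topology (beta_family \<F>)"
proof -
  have "beta_family \<F> = topspace betaN_topology - (\<Union>B\<in>Pow pnats - \<F>. basic_clopen B)"
    using betaN_sub unfolding beta_family_def basic_clopen_def topspace_betaN_topology by blast
  moreover have "openin betaN_topology (\<Union>B\<in>Pow pnats - \<F>. basic_clopen B)"
    using openin_basic_clopen by blast
  ultimately show ?thesis by (metis closedin_diff closedin_topspace)
qed

section \<open>The semigroup of ultrafilters\<close>

lemma mem_uf_add: "B \<in> uf_add p q \<longleftrightarrow> B \<subseteq> pnats \<and> {x \<in> pnats. left_shift x B \<in> q} \<in> p"
  by (simp add: uf_add_def)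

lemma left_shift_sub: "left_shift x B \<subseteq> pnats"
  by (auto simp: left_shift_def)

lemma left_shift_left_shift: "left_shift y (left_shift x B) = left_shift (x + y) B"
  by (auto simp: left_shift_def add.assoc)

lemma uf_add_in_betaN:
  assumes p: "p \<in> betaN" and q: "q \<in> betaN"
  shows "uf_add p q \<in> betaN"
  unfolding betaN_def mem_Collect_eq
proof (intro conjI ballI allI impI)
  show "uf_add p q \<subseteq> Pow pnats" by (auto simp: uf_add_def)
  have "left_shift x pnats = pnats" for x by (auto simp: left_shift_def)
  then have "{x \<in> pnats. left_shift x pnats \<in> q} = pnats" using betaN_top[OF q] by auto
  then show "pnats \<in> uf_add p q"
    using betaN_top[OF p] by (simp only: mem_uf_add subset_refl simp_thms)
  have "left_shift x {} = {}" for x by (auto simp: left_shift_def)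
  then show "{} \<notin> uf_add p q"
    using betaN_ne[OF p] betaN_ne[OF q] by (simp add: mem_uf_add)
next
  fix B C assume "B \<in> uf_add p q" "C \<in> uf_add p q"
  then have *: "B \<subseteq> pnats"
    "{x \<in> pnats. left_shift x B \<in> q} \<inter> {x \<in> pnats. left_shift x C \<in> q} \<in> p"
    using betaN_Int[OF p] by (auto simp: mem_uf_add)
  have "left_shift x (B \<inter> C) = left_shift x B \<inter> left_shift x C" for x
    by (auto simp: left_shift_def)
  then have "{x \<in> pnats. left_shift x B \<in> q} \<inter> {x \<in> pnats. left_shift x C \<in> q}
      \<subseteq> {x \<in> pnats. left_shift x (B \<inter> C) \<in> q}"
    using betaN_Int[OF q] by auto
  then have "{x \<in> pnats. left_shift x (B \<inter> C) \<in> q} \<in> p"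
    using betaN_up[OF p *(2)] by blast
  then show "B \<inter> C \<in> uf_add p q" using *(1) unfolding mem_uf_add by blast
next
  fix B C assume BC: "B \<in> uf_add p q \<and> B \<subseteq> C \<and> C \<subseteq> pnats"
  have "left_shift x B \<subseteq> left_shift x C" for x using BC by (auto simp: left_shift_def)
  then have "{x \<in> pnats. left_shift x B \<in> q} \<subseteq> {x \<in> pnats. left_shift x C \<in> q}"
    using betaN_up[OF q] left_shift_sub by blast
  then show "C \<in> uf_add p q"
    using BC betaN_up[OF p, of _ "{x \<in> pnats. left_shift x C \<in> q}"] unfolding mem_uf_add by blast
next
  fix B :: "nat set" assume B: "B \<subseteq> pnats"
  have "left_shift x (pnats - B) = pnats - left_shift x B" for x
    by (auto simp: left_shift_def)
  then have "{x \<in> pnats. left_shift x (pnats - B) \<in> q} = pnats - {x \<in> pnats. left_shift x B \<in> q}"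
    using betaN_compl_iff[OF q left_shift_sub] by auto
  then show "B \<in> uf_add p q \<or> pnats - B \<in> uf_add p q"
    using B betaN_ultra[OF p, of "{x \<in> pnats. left_shift x B \<in> q}"]
    by (auto simp: mem_uf_add)
qed

lemma uf_add_assoc: "uf_add (uf_add p q) r = uf_add p (uf_add q r)"
proof -
  have "left_shift y {x \<in> pnats. left_shift x B \<in> r}
      = {x \<in> pnats. left_shift x (left_shift y B) \<in> r}" for y B
    unfolding left_shift_left_shift by (auto simp: left_shift_def)
  moreover have "left_shift y B \<subseteq> pnats \<longleftrightarrow> True" for y B
    using left_shift_sub by blast
  ultimately show ?thesis
    by (auto simp: uf_add_def)
qed

lemma continuous_uf_add_left:
  assumes q: "q \<in> betaN"
  shows "continuous_map betaN_topology betaN_topology (\<lambda>p. uf_add p q)"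
  unfolding continuous_map_def topspace_betaN_topology
proof (intro conjI allI impI)
  show "(\<lambda>p. uf_add p q) \<in> betaN \<rightarrow> betaN" using uf_add_in_betaN[OF _ q] by blast
  fix U assume U: "openin betaN_topology U"
  show "openin betaN_topology {p \<in> betaN. uf_add p q \<in> U}"
  proof (subst openin_subopen, clarify)
    fix p assume p: "p \<in> betaN" "uf_add p q \<in> U"
    then obtain B where B: "B \<subseteq> pnats" "uf_add p q \<in> basic_clopen B" "basic_clopen B \<subseteq> U"
      using betaN_nhd_basic[OF U] by metis
    let ?C = "{x \<in> pnats. left_shift x B \<in> q}"
    have "basic_clopen ?C \<subseteq> {p \<in> betaN. uf_add p q \<in> U}"
      using B uf_add_in_betaN[OF _ q] by (auto simp: basic_clopen_def mem_uf_add)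
    moreover have "p \<in> basic_clopen ?C"
      using B(2) p(1) by (simp add: basic_clopen_def mem_uf_add)
    ultimately show "\<exists>T. openin betaN_topology T \<and> p \<in> T \<and> T \<subseteq> {p \<in> betaN. uf_add p q \<in> U}"
      using openin_basic_clopen[of ?C] by blast
  qed
qed

lemma closed_subsemigroup_has_idempotent:
  assumes S: "closedin betaN_topology S" "S \<noteq> {}"
    and add: "\<And>p q. p \<in> S \<Longrightarrow> q \<in> S \<Longrightarrow> uf_add p q \<in> S"
  obtains p where "p \<in> S" "uf_add p p = p"
proof -
  let ?X = "subtopology betaN_topology S"
  have Sb: "S \<subseteq> betaN" using closedin_subset[OF S(1)] by (simp add: topspace_betaN_topology)
  then have top: "topspace ?X = S" by (auto simp: topspace_betaN_topology)
  have "\<exists>p\<in>topspace ?X. uf_add p p = p"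
  proof (rule ellis_numakura[of ?X uf_add])
    show "compact_space ?X"
      using closedin_compact_space[OF compact_space_betaN S(1)] by (rule compact_space_subtopology)
    show "Hausdorff_space ?X"
      using Hausdorff_space_betaN by (rule Hausdorff_space_subtopology)
    show "topspace ?X \<noteq> {}" using top S(2) by simp
    show "uf_add p q \<in> topspace ?X" if "p \<in> topspace ?X" "q \<in> topspace ?X" for p q
      using that top add by simp
    show "continuous_map ?X ?X (\<lambda>p. uf_add p q)" if "q \<in> topspace ?X" for q
    proof -
      have q: "q \<in> S" using that top by simp
      then have "continuous_map ?X betaN_topology (\<lambda>p. uf_add p q)"
        using continuous_uf_add_left Sb by (intro continuous_map_from_subtopology) blast
      then show ?thesis using q add top by (auto simp: continuous_map_in_subtopology)
    qed
  qed (use uf_add_assoc in auto)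
  then show thesis using that top by blast
qed

section \<open>Idempotents attached to a family\<close>

text \<open>If \<open>B \<in> p + q\<close>, then \<open>B\<close> contains a translate \<open>x + (-x + B)\<close> of a member of \<open>q\<close>.\<close>

lemma uf_add_beta_family:
  assumes F: "is_family \<F>" "translation_invariant \<F>"
    and p: "p \<in> betaN" and q: "q \<in> beta_family \<F>"
  shows "uf_add p q \<in> beta_family \<F>"
proof -
  have qb: "q \<in> betaN" "q \<subseteq> \<F>" using q by (auto simp: beta_family_def)
  have "B \<in> \<F>" if B: "B \<in> uf_add p q" for B
  proof -
    have "{x \<in> pnats. left_shift x B \<in> q} \<noteq> {}"
      using B betaN_ne[OF p] by (metis mem_uf_add)
    then obtain x where x: "x \<in> pnats" "left_shift x B \<in> \<F>" using qb(2) by blast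
    then have "(\<lambda>a. x + a) ` left_shift x B \<in> \<F>"
      using F(2) unfolding translation_invariant_def by blast
    moreover have "(\<lambda>a. x + a) ` left_shift x B \<subseteq> B" by (auto simp: left_shift_def)
    moreover have "B \<subseteq> pnats" using B by (simp add: mem_uf_add)
    ultimately show ?thesis using F(1) unfolding is_family_def by blast
  qed
  then show ?thesis using uf_add_in_betaN[OF p qb(1)] by (auto simp: beta_family_def)
qed

lemma FS_subset_pnats:
  assumes "\<forall>n\<in>pnats. x n \<in> pnats" "m \<in> pnats"
  shows "FS x m \<subseteq> pnats"
proof
  fix s assume "s \<in> FS x m"
  then obtain H where H: "finite H" "H \<noteq> {}" "H \<subseteq> {m..}" "s = (\<Sum>t\<in>H. x t)"
    unfolding FS_def by blast
  have "x t > 0" if "t \<in> H" for t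
  proof -
    have "t \<in> pnats" using that H(3) assms(2) by auto
    then show ?thesis using bspec[OF assms(1), of t] by simp
  qed
  then have "s > 0" using H by (simp add: sum_pos)
  then show "s \<in> pnats" by simp
qed

text \<open>
  Given a finite sum \<open>s\<close>, the tail of \<open>x\<close> beyond the indices used in \<open>s\<close> has all its finite sums
  in \<open>-s + FS x m\<close>.
\<close>

lemma uf_add_FS_tails:
  assumes x: "\<forall>n\<in>pnats. x n \<in> pnats" and p: "p \<in> betaN" and q: "q \<in> betaN"
    and tails: "\<And>m. m \<in> pnats \<Longrightarrow> FS x m \<in> p" "\<And>m. m \<in> pnats \<Longrightarrow> FS x m \<in> q"
    and m: "m \<in> pnats"
  shows "FS x m \<in> uf_add p q"
proof -
  have "left_shift s (FS x m) \<in> q" if s: "s \<in> FS x m" for s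
  proof -
    obtain H where H: "finite H" "H \<noteq> {}" "H \<subseteq> {m..}" "s = (\<Sum>t\<in>H. x t)"
      using s unfolding FS_def by blast
    let ?k = "Suc (Max H)"
    have mk: "m \<le> ?k" using Max_in[OF H(1,2)] H(3) by auto
    have "FS x ?k \<subseteq> left_shift s (FS x m)"
    proof
      fix u assume u: "u \<in> FS x ?k"
      then obtain K where K: "finite K" "K \<noteq> {}" "K \<subseteq> {?k..}" "u = (\<Sum>t\<in>K. x t)"
        unfolding FS_def by blast
      have "t \<notin> K" if "t \<in> H" for t using Max_ge[OF H(1) that] K(3) by auto
      then have "H \<inter> K = {}" by blast
      then have "s + u = (\<Sum>t\<in>H \<union> K. x t)" using H K by (simp add: sum.union_disjoint)
      moreover have "K \<subseteq> {m..}" using K(3) mk by auto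
      ultimately have "s + u \<in> FS x m"
        unfolding FS_def mem_Collect_eq using H K by (intro exI[of _ "H \<union> K"]) simp
      moreover have "u \<in> pnats" using u FS_subset_pnats[OF x, of ?k] by auto
      ultimately show "u \<in> left_shift s (FS x m)" by (simp add: left_shift_def)
    qed
    then show ?thesis by (rule betaN_up[OF q tails(2) _ left_shift_sub, rotated]) simp
  qed
  then have "FS x m \<subseteq> {s \<in> pnats. left_shift s (FS x m) \<in> q}"
    using FS_subset_pnats[OF x m] by blast
  then have "{s \<in> pnats. left_shift s (FS x m) \<in> q} \<in> p"
    by (rule betaN_up[OF p tails(1)[OF m] _ Collect_restrict])
  then show ?thesis using FS_subset_pnats[OF x m] unfolding mem_uf_add by iprover
qed

lemma almost_minimal_idempotent:
  assumes F: "is_family \<F>" "translation_invariant \<F>"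
    and x: "\<forall>n\<in>pnats. x n \<in> pnats" and min: "almost_minimal \<F> x"
  obtains p where "p \<in> beta_family \<F>" "uf_add p p = p" "\<And>m. m \<in> pnats \<Longrightarrow> FS x m \<in> p"
proof -
  define S where "S = (\<Inter>m\<in>pnats. cl (FS x m)) \<inter> beta_family \<F>"
  have "p \<in> cl (FS x m) \<longleftrightarrow> p \<in> betaN \<and> FS x m \<in> p" if "m \<in> pnats" for p m
    by (simp only: cl_eq_basic_clopen[OF FS_subset_pnats[OF x that]] basic_clopen_def mem_Collect_eq)
  then have mem: "p \<in> S \<longleftrightarrow> p \<in> beta_family \<F> \<and> (\<forall>m\<in>pnats. FS x m \<in> p)" for p
    unfolding S_def beta_family_def by blast
  have "closedin betaN_topology S"
    unfolding S_def
    by (intro closedin_Int closedin_beta_family closedin_Inter) (auto simp: cl_def)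
  moreover have "S \<noteq> {}" using min unfolding almost_minimal_def S_def .
  moreover have "uf_add p q \<in> S" if "p \<in> S" "q \<in> S" for p q
  proof -
    have pq: "p \<in> betaN" "q \<in> betaN" using that by (simp_all add: mem beta_family_def)
    have "uf_add p q \<in> beta_family \<F>"
      using that mem by (intro uf_add_beta_family[OF F pq(1)]) blast
    moreover have "FS x m \<in> uf_add p q" if "m \<in> pnats" for m
      using \<open>p \<in> S\<close> \<open>q \<in> S\<close> mem by (intro uf_add_FS_tails[OF x pq _ _ that]) blast+
    ultimately show ?thesis unfolding mem by blast
  qed
  ultimately obtain p where "p \<in> S" "uf_add p p = p"
    by (rule closed_subsemigroup_has_idempotent)
  then show thesis using that mem by blast
qed

lemma essential_star_mem_idempotent:
  assumes "essential_star \<F> A" "p \<in> beta_family \<F>" "uf_add p p = p"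
  shows "A \<in> p"
proof (rule ccontr)
  assume "A \<notin> p"
  moreover have "A \<subseteq> pnats" "p \<in> betaN"
    using assms by (auto simp: essential_star_def beta_family_def)
  ultimately have "pnats - A \<in> p" using betaN_compl_iff by blast
  then have "essential \<F> (pnats - A)" using assms(2,3) unfolding essential_def by metis
  then show False using assms(1) unfolding essential_star_def by blast
qed

text \<open>
  The sets \<open>B\<close> whose quotient \<open>{m. n * m \<in> B}\<close> lies in \<open>p\<close> form the image of the ultrafilter \<open>p\<close>
  under \<open>m \<mapsto> n * m\<close>. It inherits idempotence because this map is additive, and it stays inside
  \<open>\<F>\<close> because \<open>B\<close> contains the dilation by \<open>n\<close> of its own quotient.
\<close>

lemma dilation_preimage_mem:
  assumes F: "is_family \<F>" "dilation_invariant \<F>"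
    and A: "essential_star \<F> A" and p: "p \<in> beta_family \<F>" "uf_add p p = p"
    and n: "n \<in> pnats"
  shows "{m \<in> pnats. n * m \<in> A} \<in> p"
proof -
  let ?d = "\<lambda>B. {m \<in> pnats. n * m \<in> B}"
  define r where "r = {B. B \<subseteq> pnats \<and> ?d B \<in> p}"
  have r_iff: "B \<in> r \<longleftrightarrow> B \<subseteq> pnats \<and> ?d B \<in> p" for B
    by (simp only: r_def mem_Collect_eq)
  have pb: "p \<in> betaN" "p \<subseteq> \<F>" using p(1) by (auto simp: beta_family_def)
  have dtop: "?d pnats = pnats" using n by auto
  have "r \<in> betaN"
    unfolding betaN_def mem_Collect_eq
  proof (intro conjI ballI allI impI)
    show "r \<subseteq> Pow pnats" by (auto simp: r_def)
    show "pnats \<in> r" using betaN_top[OF pb(1)] dtop by (simp add: r_def)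
    show "{} \<notin> r" using betaN_ne[OF pb(1)] by (simp add: r_def)
  next
    fix B C assume "B \<in> r" "C \<in> r"
    then have BC: "B \<subseteq> pnats" "?d B \<in> p" "?d C \<in> p" unfolding r_iff by iprover+
    have "?d (B \<inter> C) = ?d B \<inter> ?d C" by blast
    then have "?d (B \<inter> C) \<in> p" using betaN_Int[OF pb(1) BC(2,3)] by (simp only:)
    moreover have "B \<inter> C \<subseteq> pnats" using BC(1) by blast
    ultimately show "B \<inter> C \<in> r" unfolding r_iff by iprover
  next
    fix B C assume "B \<in> r \<and> B \<subseteq> C \<and> C \<subseteq> pnats"
    then have BC: "?d B \<in> p" "B \<subseteq> C" "C \<subseteq> pnats" unfolding r_iff by iprover+
    have "?d B \<subseteq> ?d C" using BC(2) by blast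
    then have "?d C \<in> p" by (rule betaN_up[OF pb(1) BC(1) _ Collect_restrict])
    then show "C \<in> r" using BC(3) unfolding r_iff by iprover
  next
    fix B :: "nat set" assume B: "B \<subseteq> pnats"
    have "?d (pnats - B) = pnats - ?d B" using n by auto
    moreover have "?d B \<in> p \<or> pnats - ?d B \<in> p" by (rule betaN_ultra[OF pb(1)]) auto
    ultimately show "B \<in> r \<or> pnats - B \<in> r" using B by (auto simp: r_def)
  qed
  moreover have "r \<subseteq> \<F>"
  proof
    fix B assume B: "B \<in> r"
    then have "(\<lambda>a. n * a) ` ?d B \<in> \<F>"
      using F(2) n pb(2) unfolding dilation_invariant_def r_def by blast
    moreover have "(\<lambda>a. n * a) ` ?d B \<subseteq> B" "B \<subseteq> pnats" using B by (auto simp: r_def)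
    ultimately show "B \<in> \<F>" using F(1) unfolding is_family_def by blast
  qed
  ultimately have "r \<in> beta_family \<F>" by (simp add: beta_family_def)
  moreover have "uf_add r r = r"
  proof -
    have "?d {u \<in> pnats. left_shift u B \<in> r} = {m \<in> pnats. left_shift m (?d B) \<in> p}" for B
    proof -
      have "?d (left_shift (n * m) B) = left_shift m (?d B)" for m
        using n by (auto simp: left_shift_def distrib_left)
      then show ?thesis using n left_shift_sub by (simp add: r_iff)
    qed
    moreover have "?d B \<in> p \<longleftrightarrow> {m \<in> pnats. left_shift m (?d B) \<in> p} \<in> p" for B
      using mem_uf_add[of "?d B" p p] Collect_restrict[of pnats "\<lambda>m. n * m \<in> B"]
      unfolding p(2) by iprover
    ultimately have "?d {u \<in> pnats. left_shift u B \<in> r} \<in> p \<longleftrightarrow> ?d B \<in> p" for B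
      by (simp only:)
    then have "B \<in> uf_add r r \<longleftrightarrow> B \<in> r" for B
      using Collect_restrict[of pnats "\<lambda>u. left_shift u B \<in> r"]
      unfolding mem_uf_add r_iff[of "{u \<in> pnats. left_shift u B \<in> r}"] r_iff[of B] by iprover
    then show ?thesis by blast
  qed
  ultimately have "A \<in> r" by (rule essential_star_mem_idempotent[OF A])
  then show ?thesis by (simp add: r_def)
qed

section \<open>Choosing the sum subsystem\<close>

text \<open>
  The first fact says \<open>B\<^sup>* \<in> p\<close>, and is \<open>B \<in> p = p + p\<close> unfolded. The second follows from it for
  \<open>B = -s + A\<close>: if \<open>y \<in> B\<^sup>*\<close>, then \<open>s + y \<in> A\<^sup>*\<close> because \<open>-y + (-s + A) = -(s + y) + A\<close>.
\<close>

lemma idempotent_star: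
  assumes p: "p \<in> betaN" "uf_add p p = p"
  shows "B \<in> p \<Longrightarrow> {a \<in> B. left_shift a B \<in> p} \<in> p"
    and "s \<in> {a \<in> A. left_shift a A \<in> p} \<Longrightarrow> left_shift s {a \<in> A. left_shift a A \<in> p} \<in> p"
proof -
  show star: "{a \<in> B. left_shift a B \<in> p} \<in> p" if "B \<in> p" for B
  proof -
    have "{a \<in> pnats. left_shift a B \<in> p} \<in> p" using that p(2) mem_uf_add[of B p p] by simp
    then have "B \<inter> {a \<in> pnats. left_shift a B \<in> p} \<in> p" using betaN_Int[OF p(1) that] by blast
    moreover have "B \<inter> {a \<in> pnats. left_shift a B \<in> p} = {a \<in> B. left_shift a B \<in> p}"
      using betaN_sub[OF p(1) that] by blast
    ultimately show ?thesis by simp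
  qed
  assume s: "s \<in> {a \<in> A. left_shift a A \<in> p}"
  let ?B = "left_shift s A"
  have "{a \<in> ?B. left_shift a ?B \<in> p} \<in> p" using s by (intro star) blast
  moreover have "{a \<in> ?B. left_shift a ?B \<in> p} \<subseteq> left_shift s {a \<in> A. left_shift a A \<in> p}"
    unfolding left_shift_left_shift by (auto simp: left_shift_def)
  ultimately show "left_shift s {a \<in> A. left_shift a A \<in> p} \<in> p"
    using betaN_up[OF p(1)] left_shift_sub by blast
qed

lemma sum_subsystem_from_idempotent:
  assumes p: "p \<in> betaN" "uf_add p p = p"
    and tails: "\<And>m. m \<in> pnats \<Longrightarrow> FS x m \<in> p"
    and A: "A \<in> p" and dil: "\<And>n. n \<in> pnats \<Longrightarrow> {m \<in> pnats. n * m \<in> A} \<in> p"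
  shows "\<exists>y. sum_subsystem y x \<and> FS y 1 \<union> FP y 1 \<subseteq> A"
proof -
  define S where "S = {a \<in> A. left_shift a A \<in> p}"
  have SA: "S \<subseteq> A" and Spos: "S \<subseteq> pnats" using betaN_sub[OF p(1) A] by (auto simp: S_def)
  have Sp: "S \<in> p" using idempotent_star(1)[OF p A] by (simp add: S_def)
  have Sshift: "left_shift s S \<in> p" if "s \<in> S" for s
    using idempotent_star(2)[OF p, of s A] that by (simp add: S_def)
  define val where "val H = (\<Sum>t\<in>H. x t)" for H
  \<comment> \<open>Including the empty set \<open>K\<close> puts the new term itself into \<open>S\<close>, and including the index 0
      does no harm, as the sums and products of terms with positive index are among those of all.\<close>
  define good where "good h n H \<longleftrightarrow> finite H \<and> H \<noteq> {} \<and> H \<subseteq> pnats \<and>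
      (\<forall>m<n. Max (h m) < Min H) \<and>
      (\<forall>K\<subseteq>{..<n}. val H + (\<Sum>i\<in>K. val (h i)) \<in> S \<and> val H * (\<Prod>i\<in>K. val (h i)) \<in> A)"
    for h :: "nat \<Rightarrow> nat set" and n H
  \<comment> \<open>A sum or product over \<open>K\<close> is controlled by the condition on the term with index \<open>Max K\<close>.\<close>
  have closed: "(\<Sum>i\<in>K. val (h i)) \<in> S \<and> (\<Prod>i\<in>K. val (h i)) \<in> A"
    if "\<And>m. m \<in> K \<Longrightarrow> good h m (h m)" "finite K" "K \<noteq> {}" for h K
  proof -
    let ?j = "Max K" and ?L = "K - {Max K}"
    have j: "?j \<in> K" using that by simp
    have "?L \<subseteq> {..<?j}" using that(2) by (auto simp: less_le)
    then have "val (h ?j) + (\<Sum>i\<in>?L. val (h i)) \<in> S \<and> val (h ?j) * (\<Prod>i\<in>?L. val (h i)) \<in> A"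
      using that(1)[OF j] unfolding good_def by blast
    then show ?thesis
      using sum.remove[OF that(2) j, of "\<lambda>i. val (h i)"] prod.remove[OF that(2) j, of "\<lambda>i. val (h i)"]
      by simp
  qed
  have "\<exists>h. \<forall>n. good h n (h n)"
  proof (rule dependent_wellorder_choice)
    fix H and f g :: "nat \<Rightarrow> nat set" and n
    assume eq: "\<And>m. m < n \<Longrightarrow> f m = g m"
    have "(\<Sum>i\<in>K. val (f i)) = (\<Sum>i\<in>K. val (g i))" "(\<Prod>i\<in>K. val (f i)) = (\<Prod>i\<in>K. val (g i))"
      if "K \<subseteq> {..<n}" for K
      using that eq by (auto intro!: sum.cong prod.cong)
    then show "good f n H = good g n H" unfolding good_def using eq by simp
  next
    fix n and h :: "nat \<Rightarrow> nat set"
    assume IH: "\<And>m. m < n \<Longrightarrow> good h m (h m)"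
    let ?\<K> = "{K. K \<subseteq> {..<n} \<and> K \<noteq> {}}"
    have fin: "finite ?\<K>" by (rule finite_subset[of _ "Pow {..<n}"]) auto
    have prev: "(\<Sum>i\<in>K. val (h i)) \<in> S \<and> (\<Prod>i\<in>K. val (h i)) \<in> A" if "K \<in> ?\<K>" for K
      using that finite_subset[of K "{..<n}"] by (intro closed IH) auto
    define k where "k = Suc (\<Sum>m<n. Max (h m))"
    have "FS x k \<in> p" by (rule tails) (simp add: k_def)
    moreover have "pnats \<inter> (\<Inter>K\<in>?\<K>. left_shift (\<Sum>i\<in>K. val (h i)) S) \<in> p"
      using prev Sshift by (intro betaN_INT[OF p(1) fin]) blast
    moreover have "pnats \<inter> (\<Inter>K\<in>?\<K>. {m \<in> pnats. (\<Prod>i\<in>K. val (h i)) * m \<in> A}) \<in> p"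
      using prev dil betaN_sub[OF p(1) A] by (intro betaN_INT[OF p(1) fin]) blast
    ultimately have "S \<inter> FS x k \<inter> (pnats \<inter> (\<Inter>K\<in>?\<K>. left_shift (\<Sum>i\<in>K. val (h i)) S))
        \<inter> (pnats \<inter> (\<Inter>K\<in>?\<K>. {m \<in> pnats. (\<Prod>i\<in>K. val (h i)) * m \<in> A})) \<in> p" (is "?I \<in> p")
      using Sp betaN_Int[OF p(1)] by blast
    then have "?I \<noteq> {}" using betaN_ne[OF p(1)] by metis
    then obtain v where "v \<in> ?I" by blast
    then have v: "v \<in> S" "v \<in> FS x k" "v \<in> (\<Inter>K\<in>?\<K>. left_shift (\<Sum>i\<in>K. val (h i)) S)"
      "v \<in> (\<Inter>K\<in>?\<K>. {m \<in> pnats. (\<Prod>i\<in>K. val (h i)) * m \<in> A})"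
      by (simp_all only: Int_iff)
    have vs: "(\<Sum>i\<in>K. val (h i)) + v \<in> S" if "K \<in> ?\<K>" for K
      using INT_D[OF v(3) that] by (simp add: left_shift_def)
    have vp: "(\<Prod>i\<in>K. val (h i)) * v \<in> A" if "K \<in> ?\<K>" for K
      using INT_D[OF v(4) that] by simp
    obtain H where H: "finite H" "H \<noteq> {}" "H \<subseteq> {k..}" "v = val H"
      using v(2) unfolding FS_def val_def by blast
    have "good h n H"
      unfolding good_def
    proof (intro conjI allI impI)
      show "finite H" "H \<noteq> {}" by (fact H)+
      show "H \<subseteq> pnats" using H(3) by (auto simp: k_def)
      show "Max (h m) < Min H" if "m < n" for m
      proof -
        have "Max (h m) \<le> (\<Sum>m<n. Max (h m))" using that by (intro member_le_sum) auto
        also have "\<dots> < k" by (simp add: k_def)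
        also have "k \<le> Min H" using H by auto
        finally show ?thesis .
      qed
      fix K assume K: "K \<subseteq> {..<n}"
      show "val H + (\<Sum>i\<in>K. val (h i)) \<in> S" "val H * (\<Prod>i\<in>K. val (h i)) \<in> A"
        using vs[of K] vp[of K] K v(1) subsetD[OF SA v(1)] H(4)
        by (cases "K = {}"; simp add: add.commute mult.commute)+
    qed
    then show "\<exists>H. good h n H" by blast
  qed
  then obtain h where h: "\<And>n. good h n (h n)" by blast
  define y where "y n = val (h n)" for n
  have "sum_subsystem y x"
    unfolding sum_subsystem_def
  proof (intro exI ballI conjI)
    fix n assume "n \<in> pnats"
    show "finite (h n)" "h n \<noteq> {}" "h n \<subseteq> pnats" using h[of n] by (auto simp: good_def)
    show "Max (h n) < Min (h (n + 1))"
      using h[of "n + 1"] less_add_one[of n] unfolding good_def by iprover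
    show "y n = (\<Sum>t\<in>h n. x t)" by (simp add: y_def val_def)
  qed
  moreover have "FS y 1 \<subseteq> A" "FP y 1 \<subseteq> A"
    using closed[OF h] SA by (auto simp: FS_def FP_def y_def)
  ultimately show ?thesis by blast
qed

theorem theorem4p11:
  fixes \<F> :: "nat set set" and x :: "nat \<Rightarrow> nat" and A :: "nat set"
  assumes "is_family \<F>"
    and "translation_invariant \<F>"
    and "dilation_invariant \<F>"
    and "ramsey_property \<F>"
    and "\<forall>n\<in>pnats. x n \<in> pnats"
    and "almost_minimal \<F> x"
    and "essential_star \<F> A"
  shows "\<exists>y. sum_subsystem y x \<and> FS y 1 \<union> FP y 1 \<subseteq> A"
proof -
  obtain p where p: "p \<in> beta_family \<F>" "uf_add p p = p"
    and tails: "\<And>m. m \<in> pnats \<Longrightarrow> FS x m \<in> p"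
    using almost_minimal_idempotent[OF assms(1,2,5,6)] by metis
  have "p \<in> betaN" using p(1) by (simp add: beta_family_def)
  then show ?thesis
    using p(2) tails
  proof (rule sum_subsystem_from_idempotent)
    show "A \<in> p" using essential_star_mem_idempotent[OF assms(7) p] .
    show "{m \<in> pnats. n * m \<in> A} \<in> p" if "n \<in> pnats" for n
      using dilation_preimage_mem[OF assms(1,3,7) p that] .
  qed
qed

end
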